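(* Let $n\geq 3$ and $d>n/2$. Then the number of zero-sum-free $d$-tuples in $\mathbb{Z}_n^d$ is $\alpha_n^d=\phi(n)\binom{n-1}{d}$.
   Context: $\mathbb{Z}_n$ is the ring of integers modulo $n$. A vector $(v_1,\dots,v_d)\in\mathbb{Z}_n^d$ is zero-sum-free if there is no non-empty subset of its components whose sum is $0$ in $\mathbb{Z}_n$; $\alpha_n^d$ denotes the number of such vectors. $\phi$ is Euler's totient function. *)

theory Defs
  imports "HOL-Number_Theory.Number_Theory" "HOL-Library.FuncSet"
begin

text \<open>
  A vector of \<open>\<int>\<^sub>n\<^sup>d\<close> is an extensional function on the index set \<open>{1..d}\<close>. A ``subset of its
  components'' is given by a set of indices, so equal entries in different positions count as
  different components.
\<close>

definition zero_sum_free :: "nat \<Rightarrow> nat \<Rightarrow> (nat \<Rightarrow> int) \<Rightarrow> bool" where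
  "zero_sum_free n d v \<longleftrightarrow>
     \<not> (\<exists>I. I \<subseteq> {1..d} \<and> I \<noteq> {} \<and>
         finsum (residue_ring (int n)) v I = \<zero>\<^bsub>residue_ring (int n)\<^esub>)"

definition zero_sum_free_vectors :: "nat \<Rightarrow> nat \<Rightarrow> (nat \<Rightarrow> int) set" where
  "zero_sum_free_vectors n d =
     {v \<in> {1..d} \<rightarrow>\<^sub>E carrier (residue_ring (int n)). zero_sum_free n d v}"

definition zsf_count :: "nat \<Rightarrow> nat \<Rightarrow> nat" where
  "zsf_count n d = card (zero_sum_free_vectors n d)"

end

theory Submission
  imports Defs
begin

text \<open>
  By a theorem of Savchev and Chen, the zero-sum-free families of more than \<open>n / 2\<close> entries in an
  abelian group of order \<open>n\<close> are exactly those of the form \<open>i \<mapsto> x\<^sub>i b\<close> with \<open>b\<close> an element of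
  order \<open>n\<close> and positive integers \<open>x\<^sub>i\<close> whose sum is less than \<open>n\<close>. The pair \<open>(b, x)\<close> is unique, and
  there are \<open>binomial (n - 1) d\<close> choices of \<open>x\<close> when there are \<open>d\<close> entries.

  The structure theorem goes by induction on the number of entries, for families having fewer subset
  sums than twice their length (the empty sum counted). If removing some entry loses at least two
  subset sums, the remaining family still satisfies the bound; its subset sums form a progression
  \<open>0, b, \<dots>, S b\<close>, which the removed entry must extend, because a translate disjoint from the
  progression would double the number of subset sums. If every removal loses just one subset sum,
  then all entries are equal.
\<close>

section \<open>Positive weights of bounded sum\<close>

definition positive_weights :: "'i set \<Rightarrow> nat \<Rightarrow> ('i \<Rightarrow> nat) set" where
  "positive_weights I m = {x \<in> I \<rightarrow>\<^sub>E {1..}. sum x I \<le> m}"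

lemma positive_weightsD:
  assumes "x \<in> positive_weights I m"
  shows "x \<in> extensional I" and "i \<in> I \<Longrightarrow> 1 \<le> x i" and "sum x I \<le> m"
  using assms by (auto simp: positive_weights_def PiE_iff)

lemma card_le_sum_positive:
  fixes x :: "'i \<Rightarrow> nat"
  assumes "\<And>i. i \<in> I \<Longrightarrow> 1 \<le> x i"
  shows "card I \<le> sum x I"
  using sum_bounded_below[of I 1 x] assms by simp

lemma ex_less_if_sum_less:
  fixes f :: "'i \<Rightarrow> nat"
  assumes "sum f I < k * card I"
  shows "\<exists>i\<in>I. f i < k"
  using sum_bounded_below[of I k f] assms by (force simp: mult.commute)

lemma positive_weights_entry_le:
  assumes "finite I" "x \<in> positive_weights I m" "i \<in> I"
  shows "x i + card I \<le> Suc m"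
proof -
  have "card (I - {i}) \<le> sum x (I - {i})"
    using positive_weightsD(2)[OF assms(2)] by (intro card_le_sum_positive) auto
  moreover have "sum x I = x i + sum x (I - {i})"
    using assms(1,3) by (rule sum.remove)
  moreover have "card I = Suc (card (I - {i}))"
    using assms(1,3) by (rule card.remove)
  ultimately show ?thesis
    using positive_weightsD(3)[OF assms(2)] by linarith
qed

lemma positive_weights_ex_one:
  assumes "x \<in> positive_weights I m" "m < 2 * card I"
  shows "\<exists>i\<in>I. x i = 1"
proof -
  have "sum x I < 2 * card I"
    using positive_weightsD(3)[OF assms(1)] assms(2) by simp
  then obtain i where "i \<in> I" "x i < 2"
    using ex_less_if_sum_less by blast
  then have "x i = 1"
    using positive_weightsD(2)[OF assms(1), of i] by simp
  with \<open>i \<in> I\<close> show ?thesis ..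
qed

text \<open>
  Small values \<open>y i\<close> determine \<open>x i = w * y i\<close>: if \<open>w \<ge> 3\<close> then \<open>x i + y i \<ge> 4\<close> for every \<open>i\<close>,
  which makes the sums too large; if \<open>w = 2\<close> then \<open>x\<close> does not take the value 1.
\<close>
lemma positive_weights_multiplier_eq_one:
  assumes fin: "finite I" and n: "m < n" "n < 2 * card I" and "w < n"
    and x: "x \<in> positive_weights I m" and y: "y \<in> positive_weights I m"
    and cong: "\<And>i. i \<in> I \<Longrightarrow> [x i = w * y i] (mod n)"
  shows "w = 1"
proof -
  have m_less: "m < 2 * card I"
    using n by simp
  obtain p where p: "p \<in> I" "x p = 1"
    using positive_weights_ex_one[OF x m_less] by blast
  obtain q where q: "q \<in> I" "y q = 1"
    using positive_weights_ex_one[OF y m_less] by blast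
  have double_less: "2 * x i < n" "2 * y i < n" if "i \<in> I" for i
    using positive_weights_entry_le[OF fin x that] positive_weights_entry_le[OF fin y that] n
    by linarith+
  have x_eq: "x i = w * y i" if "i \<in> I" "w * y i < n" for i
    using cong[OF that(1)] double_less(1)[OF that(1)] that(2)
    by (simp add: cong_less_modulus_unique_nat)
  have w: "x q = w"
    using x_eq[OF q(1)] q(2) \<open>w < n\<close> by simp
  have "1 \<le> w"
    using positive_weightsD(2)[OF x q(1)] w by simp
  moreover have "w \<noteq> 2"
    using x_eq[OF p(1)] p(2) double_less(2)[OF p(1)] by auto
  moreover have "\<not> 3 \<le> w"
  proof
    assume "3 \<le> w"
    have "(\<Sum>i\<in>I. x i + y i) < 4 * card I"
      using positive_weightsD(3)[OF x] positive_weightsD(3)[OF y] m_less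
      by (simp add: sum.distrib)
    then obtain i where i: "i \<in> I" "x i + y i < 4"
      using ex_less_if_sum_less by blast
    have pos: "1 \<le> x i" "1 \<le> y i"
      using positive_weightsD(2)[OF x i(1)] positive_weightsD(2)[OF y i(1)] .
    then have "w * y i \<le> w * 2"
      using i(2) by simp
    then have "x i = w * y i"
      using x_eq[OF i(1)] double_less(1)[OF q(1)] w by linarith
    then have "3 \<le> x i"
      using mult_le_mono[OF \<open>3 \<le> w\<close> pos(2)] by simp
    then show False
      using pos(2) i(2) by linarith
  qed
  ultimately show ?thesis
    by linarith
qed

lemma finite_positive_weights:
  assumes "finite I"
  shows "finite (positive_weights I m)"
proof (rule finite_subset)
  show "positive_weights I m \<subseteq> I \<rightarrow>\<^sub>E {..m}"
  proof
    fix x assume x: "x \<in> positive_weights I m"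
    have "x i \<le> m" if "i \<in> I" for i
      using member_le_sum[OF that, of x] assms positive_weightsD(3)[OF x] by simp
    then show "x \<in> I \<rightarrow>\<^sub>E {..m}"
      using positive_weightsD(1)[OF x] by (auto simp: PiE_iff)
  qed
  show "finite (I \<rightarrow>\<^sub>E {..m})"
    using assms by (simp add: finite_PiE)
qed

lemma positive_weights_insert:
  assumes "finite I" "i \<notin> I"
  shows "positive_weights (insert i I) m =
    (\<lambda>(k, x). x(i := k)) ` (SIGMA k:{1..m}. positive_weights I (m - k))"
proof -
  have sum_upd: "sum (x(i := k)) (insert i I) = k + sum x I" for x :: "'a \<Rightarrow> nat" and k
    using assms by (auto intro: sum.cong)
  have "positive_weights (insert i I) m =
      (\<lambda>(k, x). x(i := k)) ` {(k, x). 1 \<le> k \<and> x \<in> I \<rightarrow>\<^sub>E {1..} \<and> k + sum x I \<le> m}"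
    unfolding positive_weights_def PiE_insert_eq using sum_upd by force
  also have "{(k, x). 1 \<le> k \<and> x \<in> I \<rightarrow>\<^sub>E {1..} \<and> k + sum x I \<le> m} =
      (SIGMA k:{1..m}. positive_weights I (m - k))"
    by (auto simp: positive_weights_def)
  finally show ?thesis .
qed

lemma card_positive_weights:
  assumes "finite I"
  shows "card (positive_weights I m) = m choose card I"
  using assms
proof (induction I arbitrary: m rule: finite_induct)
  case empty
  then show ?case by (simp add: positive_weights_def)
next
  case (insert i I)
  let ?W = "SIGMA k:{1..m}. positive_weights I (m - k)"
  have "inj_on (\<lambda>(k, x). x(i := k)) ?W"
    by (rule inj_on_subset[OF inj_combinator[OF insert.hyps(2), of "\<lambda>_. {1..}"]])
      (auto simp: positive_weights_def)
  then have "card (positive_weights (insert i I) m) = card ?W"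
    by (simp add: positive_weights_insert[OF insert.hyps] card_image)
  also have "\<dots> = (\<Sum>k=1..m. (m - k) choose card I)"
    using insert.hyps(1) by (simp add: finite_positive_weights insert.IH)
  also have "\<dots> = (\<Sum>k<m. k choose card I)"
    by (rule sum.reindex_bij_witness[of _ "\<lambda>k. m - k" "\<lambda>k. m - k"]) auto
  also have "\<dots> = m choose Suc (card I)"
    using sum_choose_upper[of "card I" "m - 1"] by (cases m) (simp_all add: lessThan_Suc_atMost)
  finally show ?case
    using insert.hyps by simp
qed

section \<open>Multiples of a group element\<close>

context abelian_group
begin

lemma inj_on_add_pow_iff_nonzero:
  assumes "b \<in> carrier G"
  shows "inj_on (\<lambda>j::nat. [j] \<cdot> b) {..m} \<longleftrightarrow> (\<forall>j\<in>{1..m}. [j] \<cdot> b \<noteq> \<zero>)"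
proof
  assume inj: "inj_on (\<lambda>j::nat. [j] \<cdot> b) {..m}"
  show "\<forall>j\<in>{1..m}. [j] \<cdot> b \<noteq> \<zero>"
  proof (intro ballI notI)
    fix j assume "j \<in> {1..m}" "[j] \<cdot> b = \<zero>"
    then show False
      using inj_onD[OF inj, of j 0] by simp
  qed
next
  assume nonzero: "\<forall>j\<in>{1..m}. [j] \<cdot> b \<noteq> \<zero>"
  show "inj_on (\<lambda>j::nat. [j] \<cdot> b) {..m}"
  proof (rule linorder_inj_onI)
    fix j k :: nat
    assume jk: "j < k" "j \<in> {..m}" "k \<in> {..m}"
    have "[k] \<cdot> b = [(k - j)] \<cdot> b \<oplus> [j] \<cdot> b"
      using assms jk(1) by (simp add: add.nat_pow_mult)
    moreover have "k - j \<in> {1..m}"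
      using jk by auto
    then have "[(k - j)] \<cdot> b \<noteq> \<zero>"
      using nonzero by blast
    ultimately show "[j] \<cdot> b \<noteq> [k] \<cdot> b"
      using assms by simp
  qed auto
qed

lemma add_pow_eq_iff_cong:
  assumes "b \<in> carrier G"
  shows "[k] \<cdot> b = [l] \<cdot> b \<longleftrightarrow> [k = l] (mod add.ord b)"
proof -
  have "[k] \<cdot> b = [l] \<cdot> b \<longleftrightarrow> [(int k)] \<cdot> b = [(int l)] \<cdot> b"
    by (simp add: add_pow_int_ge)
  also have "\<dots> \<longleftrightarrow> [k = l] (mod add.ord b)"
    unfolding add.int_pow_eq[OF assms]
    by (simp add: cong_iff_dvd_diff dvd_diff_commute flip: cong_int_iff)
  finally show ?thesis .
qed

lemma finsum_add_pow:
  assumes "b \<in> carrier G" "finite T"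
  shows "(\<Oplus>i\<in>T. [x i] \<cdot> b) = [(sum x T :: nat)] \<cdot> b"
  using assms(2)
  by (induction T rule: finite_induct) (simp_all add: assms(1) add.nat_pow_mult)

lemma weights_generator_unique:
  assumes fin: "finite I" and b: "b \<in> carrier G" and c: "c \<in> carrier G"
    and ord: "m < add.ord b" "add.ord b < 2 * card I"
    and x: "x \<in> positive_weights I m" and y: "y \<in> positive_weights I m"
    and eq: "\<And>i. i \<in> I \<Longrightarrow> [x i] \<cdot> b = [y i] \<cdot> c"
  shows "b = c"
proof -
  obtain q where q: "q \<in> I" "y q = 1"
    using positive_weights_ex_one[OF y] ord by fastforce
  define w where "w = x q"
  have c_eq: "c = [w] \<cdot> b"
    using eq[OF q(1)] q(2) c by (simp add: w_def)
  have "[x i = w * y i] (mod add.ord b)" if "i \<in> I" for i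
  proof -
    have "[x i] \<cdot> b = [(w * y i)] \<cdot> b"
      using eq[OF that] b by (simp add: c_eq add.nat_pow_pow)
    then show ?thesis
      by (simp add: add_pow_eq_iff_cong[OF b])
  qed
  moreover have "w < add.ord b"
    using positive_weights_entry_le[OF fin x q(1)] ord by (simp add: w_def)
  ultimately have "w = 1"
    using positive_weights_multiplier_eq_one[OF fin ord _ x y] by blast
  then show ?thesis
    using c_eq b by simp
qed

lemma inj_on_weighted_multiples:
  assumes fin: "finite I" and n: "0 < n" "n < 2 * card I"
  shows "inj_on (\<lambda>(b, x). \<lambda>i\<in>I. [x i] \<cdot> b)
    ({b \<in> carrier G. add.ord b = n} \<times> positive_weights I (n - 1))"
proof (rule inj_onI, clarify)
  fix b c x y
  assume b: "b \<in> carrier G" "n = add.ord b" and c: "c \<in> carrier G"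
    and x: "x \<in> positive_weights I (add.ord b - 1)" and y: "y \<in> positive_weights I (add.ord b - 1)"
    and eq: "(\<lambda>i\<in>I. [x i] \<cdot> b) = (\<lambda>i\<in>I. [y i] \<cdot> c)"
  have eq_entry: "[x i] \<cdot> b = [y i] \<cdot> c" if "i \<in> I" for i
    using fun_cong[OF eq, of i] that by simp
  have b_eq_c: "b = c"
    using weights_generator_unique[OF fin b(1) c _ _ x y eq_entry] b(2) n by simp
  have "x = y"
  proof (rule extensionalityI)
    fix i assume i: "i \<in> I"
    have "x i < add.ord b" "y i < add.ord b"
      using positive_weights_entry_le[OF fin x i] positive_weights_entry_le[OF fin y i] n b(2)
      by linarith+
    then show "x i = y i"
      using add_pow_eq_iff_cong[OF b(1)] eq_entry[OF i] b_eq_c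
      by (simp add: cong_less_modulus_unique_nat)
  qed (use positive_weightsD(1)[OF x] positive_weightsD(1)[OF y] in auto)
  with b_eq_c show "b = c \<and> x = y" by simp
qed

end

section \<open>Zero-sum-free families\<close>

locale zero_sum_free_family = abelian_group G for G (structure) +
  fixes v :: "'i \<Rightarrow> 'a" and I :: "'i set"
  assumes finite_index: "finite I"
    and entries_closed: "v \<in> I \<rightarrow> carrier G"
    and no_zero_sum: "T \<subseteq> I \<Longrightarrow> T \<noteq> {} \<Longrightarrow> finsum G v T \<noteq> \<zero>"
begin

definition subset_sums :: "'i set \<Rightarrow> 'a set" where
  "subset_sums J = finsum G v ` Pow J"

lemma entry_closed: "i \<in> I \<Longrightarrow> v i \<in> carrier G"
  using entries_closed by auto

lemma finsum_closed_subset: "T \<subseteq> I \<Longrightarrow> finsum G v T \<in> carrier G"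
  using entries_closed by (intro finsum_closed) auto

lemma finsum_insert_entry:
  assumes "insert i T \<subseteq> I" "i \<notin> T"
  shows "finsum G v (insert i T) = finsum G v T \<oplus> v i"
  using assms finite_subset[OF _ finite_index] entries_closed
  by (subst finsum_insert) (auto simp: a_comm entry_closed finsum_closed_subset)

lemma finsum_subset_diff:
  assumes "T \<subseteq> J" "J \<subseteq> I"
  shows "finsum G v J = finsum G v T \<oplus> finsum G v (J - T)"
proof -
  have "finsum G v (T \<union> (J - T)) = finsum G v T \<oplus> finsum G v (J - T)"
    using assms finite_subset[OF _ finite_index] entries_closed
    by (intro finsum_Un_disjoint) auto
  then show ?thesis
    using assms(1) by (simp add: Un_absorb1)
qed

lemma subset_sums_mono: "J \<subseteq> K \<Longrightarrow> subset_sums J \<subseteq> subset_sums K"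
  by (auto simp: subset_sums_def)

lemma subset_sums_closed: "J \<subseteq> I \<Longrightarrow> subset_sums J \<subseteq> carrier G"
  by (auto simp: subset_sums_def intro: finsum_closed_subset)

lemma finite_subset_sums: "J \<subseteq> I \<Longrightarrow> finite (subset_sums J)"
  using finite_subset[OF _ finite_index] by (simp add: subset_sums_def)

lemma total_in_subset_sums: "finsum G v J \<in> subset_sums J"
  by (simp add: subset_sums_def)

lemma subset_sums_insert:
  assumes "insert i J \<subseteq> I" "i \<notin> J"
  shows "subset_sums (insert i J) = subset_sums J \<union> (\<lambda>z. z \<oplus> v i) ` subset_sums J"
proof -
  have "finsum G v ` insert i ` Pow J = (\<lambda>z. z \<oplus> v i) ` subset_sums J"
    unfolding subset_sums_def image_image
    using assms by (intro image_cong finsum_insert_entry) auto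
  then show ?thesis
    by (simp add: subset_sums_def Pow_insert image_Un)
qed

lemma ex_subset_sum_add_entry_in_subset_sums:
  assumes "insert i J \<subseteq> I" "i \<notin> J"
    and card: "card (subset_sums (insert i J)) < 2 * card (subset_sums J)"
  shows "\<exists>z\<in>subset_sums J. z \<oplus> v i \<in> subset_sums J"
proof -
  let ?translate = "(\<lambda>z. z \<oplus> v i) ` subset_sums J"
  have fin: "finite (subset_sums J)"
    using assms(1) by (simp add: finite_subset_sums)
  have "inj_on (\<lambda>z. z \<oplus> v i) (subset_sums J)"
    using assms(1) subset_sums_closed[of J]
    by (intro inj_on_subset[OF add.inj_on_multc]) (auto intro: entry_closed)
  then have "card ?translate = card (subset_sums J)"
    by (rule card_image)
  then have "subset_sums J \<inter> ?translate \<noteq> {}"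
    using card card_Un_disjoint[OF fin finite_imageI[OF fin], of "\<lambda>z. z \<oplus> v i"]
    by (auto simp: subset_sums_insert[OF assms(1,2)])
  then show ?thesis by auto
qed

lemma subset_sum_add_entry_nonzero:
  assumes "insert i J \<subseteq> I" "i \<notin> J" "z \<in> subset_sums J"
  shows "z \<oplus> v i \<noteq> \<zero>"
proof -
  obtain T where T: "T \<subseteq> J" "z = finsum G v T"
    using assms(3) by (auto simp: subset_sums_def)
  then have "z \<oplus> v i = finsum G v (insert i T)"
    using assms(1,2) by (subst finsum_insert_entry) auto
  then show ?thesis
    using no_zero_sum[of "insert i T"] assms(1) T(1) by auto
qed

lemma total_notin_subset_sums_psubset:
  assumes "J \<subset> K" "K \<subseteq> I"
  shows "finsum G v K \<notin> subset_sums J"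
proof
  assume "finsum G v K \<in> subset_sums J"
  then obtain T where T: "T \<subseteq> J" "finsum G v K = finsum G v T"
    by (auto simp: subset_sums_def)
  have closed: "finsum G v T \<in> carrier G" "finsum G v (K - T) \<in> carrier G"
    using T(1) assms by (auto intro!: finsum_closed_subset)
  have "finsum G v T \<oplus> finsum G v (K - T) = finsum G v T"
    using finsum_subset_diff[of T K] T assms by auto
  then have "finsum G v (K - T) = \<zero>"
    using closed by simp
  then show False
    using no_zero_sum[of "K - T"] T(1) assms by auto
qed

lemma card_subset_sums_psubset:
  assumes "J \<subset> K" "K \<subseteq> I"
  shows "card (subset_sums J) < card (subset_sums K)"
  using total_notin_subset_sums_psubset[OF assms] total_in_subset_sums[of K]
    subset_sums_mono[of J K] finite_subset_sums[OF assms(2)] assms(1)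
  by (intro psubset_card_mono) auto

lemma subset_sums_psubset_eq:
  assumes "J \<subset> K" "K \<subseteq> I" "card (subset_sums K) = Suc (card (subset_sums J))"
  shows "subset_sums J = subset_sums K - {finsum G v K}"
proof (rule card_subset_eq)
  show "finite (subset_sums K - {finsum G v K})"
    using finite_subset_sums[OF assms(2)] by simp
  show "subset_sums J \<subseteq> subset_sums K - {finsum G v K}"
    using total_notin_subset_sums_psubset[OF assms(1,2)] subset_sums_mono[of J K] assms(1) by auto
  show "card (subset_sums J) = card (subset_sums K - {finsum G v K})"
    using assms(3) total_in_subset_sums[of K] by simp
qed

text \<open>
  If the sum over some \<open>T \<subseteq> K\<close> had this value, then \<open>- v j\<close>, being the sum over \<open>K - T\<close>, would be a
  subset sum of \<open>L\<close>.
\<close>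
lemma total_add_entry_notin_subset_sums:
  assumes "K \<subseteq> I" "insert j L \<subseteq> I" "j \<notin> L" "subset_sums K \<subseteq> subset_sums L"
  shows "finsum G v K \<oplus> v j \<notin> subset_sums K"
proof
  assume "finsum G v K \<oplus> v j \<in> subset_sums K"
  then obtain T where T: "T \<subseteq> K" "finsum G v K \<oplus> v j = finsum G v T"
    by (auto simp: subset_sums_def)
  define z where "z = finsum G v (K - T)"
  have closed: "finsum G v K \<in> carrier G" "v j \<in> carrier G" "z \<in> carrier G"
    unfolding z_def using assms(1,2) by (auto intro!: finsum_closed_subset entry_closed)
  have "finsum G v K = finsum G v K \<oplus> v j \<oplus> z"
    using finsum_subset_diff[OF T(1) assms(1)] T(2) by (simp add: z_def)
  also have "\<dots> = finsum G v K \<oplus> (z \<oplus> v j)"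
    using closed by (simp add: a_ac)
  finally have "z \<oplus> v j = \<zero>"
    using closed by simp
  moreover have "z \<in> subset_sums L"
    using assms(4) by (auto simp: subset_sums_def z_def)
  ultimately show False
    using subset_sum_add_entry_nonzero[OF assms(2,3)] by blast
qed

text \<open>
  Removing \<open>i\<close> or \<open>j\<close> leaves the same subset sums, namely all but the total. Replacing \<open>v i\<close> by
  \<open>v j\<close> in the total yields a subset sum that none of these equals, so it is the total.
\<close>
lemma entries_eq_if_removals_lose_one:
  assumes J: "J \<subseteq> I" "i \<in> J" "j \<in> J"
    and card_i: "card (subset_sums J) = Suc (card (subset_sums (J - {i})))"
    and card_j: "card (subset_sums J) = Suc (card (subset_sums (J - {j})))"
  shows "v i = v j"
proof -
  have remove_i: "subset_sums (J - {i}) = subset_sums J - {finsum G v J}"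
    and remove_j: "subset_sums (J - {j}) = subset_sums J - {finsum G v J}"
    using subset_sums_psubset_eq[OF _ J(1) card_i] subset_sums_psubset_eq[OF _ J(1) card_j] J(2,3)
    by blast+
  have closed: "v i \<in> carrier G" "v j \<in> carrier G" "finsum G v (J - {i}) \<in> carrier G"
    using J by (auto intro: entry_closed finsum_closed_subset)
  have "finsum G v (J - {i}) \<in> subset_sums (J - {j})"
    using total_in_subset_sums[of "J - {i}"] remove_i remove_j by simp
  then have "finsum G v (J - {i}) \<oplus> v j \<in> subset_sums J"
    using subset_sums_insert[of j "J - {j}"] J by (auto simp: insert_absorb)
  moreover have "finsum G v (J - {i}) \<oplus> v j \<notin> subset_sums (J - {i})"
    using remove_i remove_j J
    by (intro total_add_entry_notin_subset_sums[of _ j "J - {j}"]) auto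
  ultimately have "finsum G v (J - {i}) \<oplus> v j = finsum G v J"
    using remove_i by simp
  also have "\<dots> = finsum G v (J - {i}) \<oplus> v i"
    using finsum_insert_entry[of i "J - {i}"] J by (simp add: insert_absorb)
  finally show ?thesis
    using closed by (simp add: a_comm[of "finsum G v (J - {i})"])
qed

definition progression :: "'i set \<Rightarrow> 'a \<Rightarrow> ('i \<Rightarrow> nat) \<Rightarrow> bool" where
  "progression J b x \<longleftrightarrow>
     b \<in> carrier G \<and> (\<forall>i\<in>J. 1 \<le> x i \<and> v i = [x i] \<cdot> b) \<and>
     bij_betw (\<lambda>j. [j] \<cdot> b) {..sum x J} (subset_sums J)"

lemma progression_card_subset_sums:
  assumes "progression J b x"
  shows "card (subset_sums J) = Suc (sum x J)"
proof -
  have "bij_betw (\<lambda>j. [j] \<cdot> b) {..sum x J} (subset_sums J)"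
    using assms by (simp add: progression_def)
  from bij_betw_same_card[OF this] show ?thesis by simp
qed

lemma progression_card_le: "progression J b x \<Longrightarrow> card J \<le> sum x J"
  by (intro card_le_sum_positive) (simp add: progression_def)

lemma progression_insert:
  assumes J: "insert i J \<subseteq> I" "i \<notin> J" and prog: "progression J b x"
    and t: "1 \<le> t" "t \<le> Suc (sum x J)" "v i = [t] \<cdot> b"
  shows "progression (insert i J) b (x(i := t))"
proof -
  let ?S = "sum x J" and ?mult = "\<lambda>j::nat. [j] \<cdot> b"
  have b: "b \<in> carrier G" and inj: "inj_on ?mult {..?S}" and sums: "subset_sums J = ?mult ` {..?S}"
    using prog by (auto simp: progression_def bij_betw_def)
  have sum_upd: "sum (x(i := t)) (insert i J) = ?S + t"
    using J finite_subset[OF _ finite_index, of J] by (auto simp: add.commute intro: sum.cong)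
  have "(\<lambda>z. z \<oplus> v i) ` subset_sums J = ?mult ` (\<lambda>j. j + t) ` {..?S}"
    unfolding sums image_image t(3) using b by (simp add: add.nat_pow_mult)
  also have "(\<lambda>j. j + t) ` {..?S} = {t..?S + t}"
    by (simp add: atMost_atLeast0)
  finally have "subset_sums (insert i J) = ?mult ` ({..?S} \<union> {t..?S + t})"
    by (simp add: subset_sums_insert[OF J] sums image_Un)
  also have "{..?S} \<union> {t..?S + t} = {..?S + t}"
    using t(2) by auto
  finally have "subset_sums (insert i J) = ?mult ` {..?S + t}" .
  moreover have "inj_on ?mult {..?S + t}"
    unfolding inj_on_add_pow_iff_nonzero[OF b]
  proof
    fix j assume j: "j \<in> {1..?S + t}"
    show "[j] \<cdot> b \<noteq> \<zero>"
    proof (cases "j \<le> ?S")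
      case True
      then show ?thesis using inj j by (simp add: inj_on_add_pow_iff_nonzero[OF b])
    next
      case False
      then have "[j] \<cdot> b = [(j - t)] \<cdot> b \<oplus> v i"
        using t b by (simp add: add.nat_pow_mult)
      moreover have "[(j - t)] \<cdot> b \<in> subset_sums J"
        using j sums by auto
      ultimately show ?thesis using subset_sum_add_entry_nonzero[OF J] by simp
    qed
  qed
  ultimately show ?thesis
    using prog t sum_upd J(2) by (auto simp: progression_def bij_betw_def)
qed

lemma progression_if_constant:
  assumes "J \<subseteq> I" "b \<in> carrier G" "\<And>i. i \<in> J \<Longrightarrow> v i = b"
  shows "\<exists>x. progression J b x"
  using finite_subset[OF assms(1) finite_index] assms
proof (induction J rule: finite_induct)
  case empty
  then show ?case by (simp add: progression_def subset_sums_def bij_betw_def)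
next
  case (insert i J)
  then obtain x where "progression J b x" by auto
  then have "progression (insert i J) b (x(i := 1))"
    using insert by (intro progression_insert) auto
  then show ?case by blast
qed

lemma entry_extends_progression:
  assumes J: "insert i J \<subseteq> I" "i \<notin> J" and prog: "progression J b x"
    and card: "card (subset_sums (insert i J)) < 2 * card (subset_sums J)"
  obtains t where "1 \<le> t" "t \<le> sum x J" "v i = [t] \<cdot> b"
proof -
  have b: "b \<in> carrier G" and sums: "subset_sums J = (\<lambda>j. [j] \<cdot> b) ` {..sum x J}"
    using prog by (auto simp: progression_def bij_betw_def)
  have v: "v i \<in> carrier G"
    using J(1) by (simp add: entry_closed)
  obtain j k where jk: "j \<le> sum x J" "k \<le> sum x J" "[k] \<cdot> b = [j] \<cdot> b \<oplus> v i"
    using ex_subset_sum_add_entry_in_subset_sums[OF J card] unfolding sums by force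
  have "j < k"
  proof (rule ccontr)
    assume "\<not> j < k"
    then have "[j] \<cdot> b = [k] \<cdot> b \<oplus> [(j - k)] \<cdot> b"
      using b by (simp add: add.nat_pow_mult)
    then have "[k] \<cdot> b = [k] \<cdot> b \<oplus> ([(j - k)] \<cdot> b \<oplus> v i)"
      using jk(3) b v by (simp add: a_assoc a_comm[of "v i"])
    then have "[(j - k)] \<cdot> b \<oplus> v i = \<zero>"
      using b v by simp
    moreover have "[(j - k)] \<cdot> b \<in> subset_sums J"
      using jk(1) sums by auto
    ultimately show False
      using subset_sum_add_entry_nonzero[OF J] by simp
  qed
  then have "[(k - j)] \<cdot> b \<oplus> [j] \<cdot> b = v i \<oplus> [j] \<cdot> b"
    using jk(3) b v by (simp add: add.nat_pow_mult a_comm)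
  then have "v i = [(k - j)] \<cdot> b"
    using b v by simp
  with \<open>j < k\<close> jk(2) show thesis
    by (intro that[of "k - j"]) auto
qed

theorem ex_progression:
  assumes "J \<subseteq> I" "card (subset_sums J) < 2 * card J"
  shows "\<exists>b x. progression J b x"
  using finite_subset[OF assms(1) finite_index] assms
proof (induction J rule: finite_psubset_induct)
  case (psubset J)
  show ?case
  proof (cases "\<forall>i\<in>J. card (subset_sums J) = Suc (card (subset_sums (J - {i})))")
    case True
    obtain k where k: "k \<in> J"
      using psubset.prems(2) by fastforce
    have "\<forall>i\<in>J. v i = v k"
      using True k entries_eq_if_removals_lose_one[OF psubset.prems(1)] by blast
    then show ?thesis
      using progression_if_constant[OF psubset.prems(1) entry_closed[of k]] k psubset.prems(1)
      by blast
  next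
    case False
    then obtain i where i: "i \<in> J" "card (subset_sums J) \<noteq> Suc (card (subset_sums (J - {i})))"
      by blast
    let ?J = "J - {i}"
    have J: "insert i ?J \<subseteq> I" "i \<notin> ?J" "insert i ?J = J"
      using i(1) psubset.prems(1) by auto
    have card_J: "card J = Suc (card ?J)"
      using psubset.hyps i(1) by (rule card.remove)
    have "card (subset_sums ?J) < card (subset_sums J)"
      using i(1) psubset.prems(1) by (intro card_subset_sums_psubset) auto
    then have "card (subset_sums ?J) < 2 * card ?J"
      using i(2) psubset.prems(2) card_J by linarith
    then obtain b x where prog: "progression ?J b x"
      using psubset.IH[of ?J] i(1) J(1) by auto
    have "card (subset_sums J) < 2 * card (subset_sums ?J)"
      using psubset.prems(2) card_J progression_card_le[OF prog]
        progression_card_subset_sums[OF prog]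
      by linarith
    then obtain t where "1 \<le> t" "t \<le> sum x ?J" "v i = [t] \<cdot> b"
      using entry_extends_progression[OF J(1,2) prog] J(3) by metis
    then show ?thesis
      using progression_insert[OF J(1,2) prog, of t] J(3) by auto
  qed
qed

theorem savchev_chen:
  assumes "finite (carrier G)" "order G < 2 * card I"
  obtains b x where "b \<in> carrier G" "add.ord b = order G" "x \<in> positive_weights I (order G - 1)"
    "\<forall>i\<in>I. v i = [x i] \<cdot> b"
proof -
  have card_le: "card (subset_sums I) \<le> order G"
    unfolding order_def using assms(1) subset_sums_closed by (intro card_mono) auto
  then obtain b x where prog: "progression I b x"
    using ex_progression[of I] assms(2) by auto
  have b: "b \<in> carrier G"
    using prog by (simp add: progression_def)
  have sum_x: "card I \<le> sum x I" "sum x I < order G"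
    using progression_card_le[OF prog] progression_card_subset_sums[OF prog] card_le by auto
  have "\<forall>j\<in>{1..sum x I}. [j] \<cdot> b \<noteq> \<zero>"
    using prog inj_on_add_pow_iff_nonzero[OF b] by (simp add: progression_def bij_betw_def)
  then have "sum x I < add.ord b"
    using add.ord_ge_1[OF assms(1) b] add.pow_ord_eq_1[OF b] by (meson atLeastAtMost_iff not_le)
  moreover obtain k where k: "order G = add.ord b * k"
    using add.ord_dvd_group_order[OF b] by (auto simp: order_def)
  ultimately have "add.ord b * k < add.ord b * 2"
    using assms(2) sum_x(1) by linarith
  then have "k = 1"
    using k sum_x(2) by (cases k) auto
  then have "add.ord b = order G"
    using k by simp
  moreover have "restrict x I \<in> positive_weights I (order G - 1)"
    using prog sum_x(2) by (auto simp: positive_weights_def progression_def)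
  moreover have "\<forall>i\<in>I. v i = [(restrict x I i)] \<cdot> b"
    using prog by (simp add: progression_def)
  ultimately show thesis
    using that b by blast
qed

end

context abelian_group
begin

lemma zero_sum_free_family_weights:
  assumes "finite I" "b \<in> carrier G" "x \<in> positive_weights I m" "m < add.ord b"
  shows "zero_sum_free_family G (\<lambda>i\<in>I. [x i] \<cdot> b) I"
proof
  show "(\<lambda>i\<in>I. [x i] \<cdot> b) \<in> I \<rightarrow> carrier G"
    using assms(2) by auto
  fix T assume T: "T \<subseteq> I" "T \<noteq> {}"
  then have fin: "finite T"
    using assms(1) finite_subset by blast
  have "finsum G (\<lambda>i\<in>I. [x i] \<cdot> b) T = (\<Oplus>i\<in>T. [x i] \<cdot> b)"
    using T(1) assms(2) by (intro finsum_cong') auto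
  also have "\<dots> = [(sum x T)] \<cdot> b"
    by (rule finsum_add_pow[OF assms(2) fin])
  finally have sum_eq: "finsum G (\<lambda>i\<in>I. [x i] \<cdot> b) T = [(sum x T)] \<cdot> b" .
  have "card T \<le> sum x T"
    using positive_weightsD(2)[OF assms(3)] T(1) by (intro card_le_sum_positive) auto
  then have "0 < sum x T"
    using T(2) fin by (metis card_gt_0_iff less_le_trans)
  moreover have "sum x T \<le> sum x I"
    using assms(1) T(1) by (intro sum_mono2) auto
  then have "sum x T < add.ord b"
    using positive_weightsD(3)[OF assms(3)] assms(4) by linarith
  ultimately have "\<not> add.ord b dvd sum x T"
    by (simp add: nat_dvd_not_less)
  then show "finsum G (\<lambda>i\<in>I. [x i] \<cdot> b) T \<noteq> \<zero>"
    using assms(2) by (simp add: sum_eq add.pow_eq_id)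
qed (fact assms(1))

theorem card_zero_sum_free_families:
  assumes "finite (carrier G)" "finite I" "order G < 2 * card I"
  shows "card {v \<in> I \<rightarrow>\<^sub>E carrier G. zero_sum_free_family G v I} =
    card {b \<in> carrier G. add.ord b = order G} * (order G - 1 choose card I)"
proof -
  let ?pairs = "{b \<in> carrier G. add.ord b = order G} \<times> positive_weights I (order G - 1)"
  let ?family = "\<lambda>(b, x). \<lambda>i\<in>I. [x i] \<cdot> b"
  have order_pos: "0 < order G"
    using assms(1) add.one_closed by (auto simp: order_def card_gt_0_iff)
  have "{v \<in> I \<rightarrow>\<^sub>E carrier G. zero_sum_free_family G v I} = ?family ` ?pairs"
  proof (intro equalityI subsetI)
    fix v assume v: "v \<in> {v \<in> I \<rightarrow>\<^sub>E carrier G. zero_sum_free_family G v I}"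
    then interpret zero_sum_free_family G v I by simp
    obtain b x where b: "b \<in> carrier G" "add.ord b = order G"
      and x: "x \<in> positive_weights I (order G - 1)" and vx: "\<forall>i\<in>I. v i = [x i] \<cdot> b"
      using savchev_chen[OF assms(1,3)] .
    have "v = (\<lambda>i\<in>I. [x i] \<cdot> b)"
      using v vx by (intro extensionalityI[of v I]) (auto simp: PiE_iff)
    then show "v \<in> ?family ` ?pairs"
      using b x by (intro image_eqI[of _ _ "(b, x)"]) auto
  next
    fix v assume "v \<in> ?family ` ?pairs"
    then obtain b x where v: "v = (\<lambda>i\<in>I. [x i] \<cdot> b)" and b: "b \<in> carrier G" "add.ord b = order G"
      and x: "x \<in> positive_weights I (order G - 1)"
      by auto
    then have "zero_sum_free_family G v I"
      using zero_sum_free_family_weights[OF assms(2) b(1) x] order_pos by simp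
    then show "v \<in> {v \<in> I \<rightarrow>\<^sub>E carrier G. zero_sum_free_family G v I}"
      using v b(1) by auto
  qed
  then show ?thesis
    using inj_on_weighted_multiples[OF assms(2) order_pos assms(3)]
    by (simp add: card_image card_cartesian_product card_positive_weights[OF assms(2)])
qed

end

section \<open>Residue rings\<close>

context residues
begin

lemma res_add_pow: "x \<in> carrier R \<Longrightarrow> [(k::nat)] \<cdot> x = (int k * x) mod m"
  by (induction k) (simp_all add: res_zero_eq res_add_eq mod_simps algebra_simps)

lemma res_order: "order R = nat m"
  by (simp add: order_def res_carrier_eq)

lemma res_ord_one: "add.ord \<one> = nat m"
proof -
  have "[(k::nat)] \<cdot> \<one> = \<zero> \<longleftrightarrow> nat m dvd k" for k
    using res_add_pow[OF one_closed, of k] m_gt_one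
    by (simp add: res_zero_eq res_one_eq nat_dvd_iff flip: dvd_eq_mod_eq_0)
  then show ?thesis
    unfolding add.ord_unique[OF one_closed] by blast
qed

lemma res_ord_eq_iff_unit:
  assumes "b \<in> carrier R"
  shows "add.ord b = nat m \<longleftrightarrow> b \<in> Units R"
proof -
  have b: "0 \<le> b" "b < m"
    using assms by (auto simp: res_carrier_eq)
  have b_eq: "[(nat b)] \<cdot> \<one> = b"
    using res_add_pow[OF one_closed, of "nat b"] b by (simp add: res_one_eq)
  have "add.ord b = (if nat b = 0 then 1 else nat m div gcd (nat m) (nat b))"
    using add.ord_pow_gen[OF one_closed, of "nat b"] unfolding res_ord_one b_eq .
  also have "\<dots> = nat m \<longleftrightarrow> 0 < b \<and> gcd (nat m) (nat b) = 1"
    using b m_gt_one by (auto simp: div_eq_dividend_iff)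
  also have "gcd (nat m) (nat b) = 1 \<longleftrightarrow> coprime b m"
    using b m_gt_one coprime_int_iff[of "nat m" "nat b"]
    by (simp add: coprime_commute coprime_iff_gcd_eq_1[symmetric] del: One_nat_def)
  also have "0 < b \<and> coprime b m \<longleftrightarrow> b \<in> Units R"
    using b by (simp add: res_units_eq)
  finally show ?thesis .
qed

lemma card_res_generators: "card {b \<in> carrier R. add.ord b = order R} = totient (nat m)"
proof -
  have "{b \<in> carrier R. add.ord b = order R} = Units R"
    using res_ord_eq_iff_unit by (auto simp: res_order)
  then show ?thesis
    by (simp add: totient_eq)
qed

end

lemma zero_sum_free_iff_family:
  assumes "n \<ge> 2" "v \<in> {1..d} \<rightarrow> carrier (residue_ring (int n))"
  shows "zero_sum_free n d v \<longleftrightarrow> zero_sum_free_family (residue_ring (int n)) v {1..d}"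
proof -
  interpret residues "int n" "residue_ring (int n)"
    using assms(1) by unfold_locales auto
  show ?thesis
    using assms(2) abelian_group
    by (auto simp: zero_sum_free_def zero_sum_free_family_def zero_sum_free_family_axioms_def)
qed

theorem theorem2p5:
  fixes n d :: nat
  assumes "n \<ge> 3" and "real d > real n / 2"
  shows "zsf_count n d = totient n * ((n - 1) choose d)"
proof -
  let ?R = "residue_ring (int n)"
  interpret residues "int n" ?R
    using assms(1) by unfold_locales auto
  have order: "order ?R = n" and order_less: "order ?R < 2 * card {1..d}"
    using assms(2) res_order by auto
  have "zero_sum_free_vectors n d =
      {v \<in> {1..d} \<rightarrow>\<^sub>E carrier ?R. zero_sum_free_family ?R v {1..d}}"
    using zero_sum_free_iff_family[of n _ d] assms(1)
    by (auto simp: zero_sum_free_vectors_def PiE_def)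
  then have "zsf_count n d =
      card {b \<in> carrier ?R. add.ord b = order ?R} * (order ?R - 1 choose d)"
    using card_zero_sum_free_families[OF finite _ order_less] by (simp add: zsf_count_def)
  then show ?thesis
    using card_res_generators order by simp
qed

end
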